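(* For every integer $n\ge 0$, the bicomplex Pell numbers satisfy $$BP_n\times(BP_n)_i^*=2(-Q_{2n+3}+j\,P_{2n+3}),$$ $$BP_n\times(BP_n)_j^*=(P_n^2-P_{n+1}^2+P_{n+2}^2-P_{n+3}^2)+4i\,(P_{2n+3}+P_nP_{n+1}),$$ $$BP_n\times(BP_n)_{ij}^*=6P_{2n+3}+4ij\,(-1)^{n+1},$$ $$BP_n\times(BP_n)_i^*+BP_{n-1}\times(BP_{n-1})_i^*=2(8P_{2n+2}+j\,Q_{2n+2}),$$ $$BP_n\times(BP_n)_j^*+BP_{n-1}\times(BP_{n-1})_j^*=12(-P_{2n+2}+i\,P_{2n+2}),$$ $$BP_n\times(BP_n)_{ij}^*+BP_{n-1}\times(BP_{n-1})_{ij}^*=6\,Q_{2n+2}.$$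
   Context: The bicomplex numbers $\mathbb{C}_2=\{q_1+iq_2+jq_3+ijq_4 : q_1,q_2,q_3,q_4\in\mathbb{R}\}$ form the commutative associative real algebra with basis $1,i,j,ij$ and multiplication (denoted $\times$ or by juxtaposition) determined by $i^2=-1$, $j^2=-1$, $ij=ji$ (so $(ij)^2=1$). For $q=q_1+iq_2+jq_3+ijq_4$ the three conjugations are $q_i^*=q_1-iq_2+jq_3-ijq_4$, $q_j^*=q_1+iq_2-jq_3-ijq_4$, $q_{ij}^*=q_1-iq_2-jq_3+ijq_4$. The Pell numbers are given by $P_0=0$, $P_1=1$, $P_n=2P_{n-1}+P_{n-2}$ and the Pell-Lucas numbers by $Q_0=2$, $Q_1=2$, $Q_n=2Q_{n-1}+Q_{n-2}$; both sequences are extended to all integer indices by the recurrence. The bicomplex Pell numbers are $BP_n=P_n+iP_{n+1}+jP_{n+2}+ijP_{n+3}$.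
   Formalization: In the fourth identity the right-hand side is corrected to 2(-8P_{2n+2} + j Q_{2n+2}); the printed 2(8P_{2n+2} + j Q_{2n+2}) has a sign error and fails for every n ≥ 0 (at n = 0 the left side is -32+12j, the printed right side 32+12j). *)

theory Defs
  imports Complex_Main
begin

text \<open>
  \<open>Bicomplex q1 q2 q3 q4\<close> is \<open>q1 + i q2 + j q3 + ij q4\<close>. The real numbers are embedded by
  \<^const>\<open>of_real\<close> (and the integers by \<^const>\<open>of_int\<close>).
\<close>

datatype bicomplex = Bicomplex (bc1: real) (bc2: real) (bc3: real) (bc4: real)

lemma bicomplex_eq_iff:
  "p = q \<longleftrightarrow> bc1 p = bc1 q \<and> bc2 p = bc2 q \<and> bc3 p = bc3 q \<and> bc4 p = bc4 q"
  by (cases p; cases q) simp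

instantiation bicomplex :: "{comm_ring_1, real_algebra_1}"
begin

definition zero_bicomplex where "0 = Bicomplex 0 0 0 0"
definition one_bicomplex where "1 = Bicomplex 1 0 0 0"
definition plus_bicomplex where
  "p + q = Bicomplex (bc1 p + bc1 q) (bc2 p + bc2 q) (bc3 p + bc3 q) (bc4 p + bc4 q)"
definition uminus_bicomplex where
  "- p = Bicomplex (- bc1 p) (- bc2 p) (- bc3 p) (- bc4 p)"
definition minus_bicomplex where
  "p - q = Bicomplex (bc1 p - bc1 q) (bc2 p - bc2 q) (bc3 p - bc3 q) (bc4 p - bc4 q)"
definition scaleR_bicomplex where
  "r *\<^sub>R p = Bicomplex (r * bc1 p) (r * bc2 p) (r * bc3 p) (r * bc4 p)"
definition times_bicomplex where
  "p * q = Bicomplex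
     (bc1 p * bc1 q - bc2 p * bc2 q - bc3 p * bc3 q + bc4 p * bc4 q)
     (bc1 p * bc2 q + bc2 p * bc1 q - bc3 p * bc4 q - bc4 p * bc3 q)
     (bc1 p * bc3 q + bc3 p * bc1 q - bc2 p * bc4 q - bc4 p * bc2 q)
     (bc1 p * bc4 q + bc4 p * bc1 q + bc2 p * bc3 q + bc3 p * bc2 q)"

instance
  by standard
    (simp_all add: bicomplex_eq_iff zero_bicomplex_def one_bicomplex_def plus_bicomplex_def
      uminus_bicomplex_def minus_bicomplex_def scaleR_bicomplex_def times_bicomplex_def
      algebra_simps)

end

definition bc_i :: bicomplex where "bc_i = Bicomplex 0 1 0 0"
definition bc_j :: bicomplex where "bc_j = Bicomplex 0 0 1 0"

lemma bc_i_squared: "bc_i * bc_i = - 1"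
  and bc_j_squared: "bc_j * bc_j = - 1"
  and bc_ij: "bc_i * bc_j = Bicomplex 0 0 0 1"
  by (simp_all add: bc_i_def bc_j_def times_bicomplex_def uminus_bicomplex_def one_bicomplex_def)

lemma Bicomplex_expand:
  "Bicomplex a b c d =
     of_real a + bc_i * of_real b + bc_j * of_real c + bc_i * bc_j * of_real d"
  by (simp add: bicomplex_eq_iff of_real_def bc_i_def bc_j_def times_bicomplex_def
      plus_bicomplex_def scaleR_bicomplex_def one_bicomplex_def)

definition conj_i :: "bicomplex \<Rightarrow> bicomplex" where
  "conj_i q = Bicomplex (bc1 q) (- bc2 q) (bc3 q) (- bc4 q)"

definition conj_j :: "bicomplex \<Rightarrow> bicomplex" where
  "conj_j q = Bicomplex (bc1 q) (bc2 q) (- bc3 q) (- bc4 q)"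

definition conj_ij :: "bicomplex \<Rightarrow> bicomplex" where
  "conj_ij q = Bicomplex (bc1 q) (- bc2 q) (- bc3 q) (bc4 q)"

text \<open>
  For negative indices the recurrence is run backwards: \<open>P n = P (n + 2) - 2 P (n + 1)\<close>,
  and likewise for \<open>Q\<close>.
\<close>

function pell :: "int \<Rightarrow> int" where
  "pell n =
     (if n = 0 then 0 else if n = 1 then 1
      else if n > 1 then 2 * pell (n - 1) + pell (n - 2)
      else pell (n + 2) - 2 * pell (n + 1))"
  by auto
termination
  by (relation "measure (\<lambda>n. nat (if n \<ge> 0 then n else 1 - n))") auto

function pell_lucas :: "int \<Rightarrow> int" where
  "pell_lucas n =
     (if n = 0 then 2 else if n = 1 then 2
      else if n > 1 then 2 * pell_lucas (n - 1) + pell_lucas (n - 2)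
      else pell_lucas (n + 2) - 2 * pell_lucas (n + 1))"
  by auto
termination
  by (relation "measure (\<lambda>n. nat (if n \<ge> 0 then n else 1 - n))") auto

declare pell.simps [simp del] pell_lucas.simps [simp del]

lemma pell_0: "pell 0 = 0" and pell_1: "pell 1 = 1"
  and pell_lucas_0: "pell_lucas 0 = 2" and pell_lucas_1: "pell_lucas 1 = 2"
  by (simp_all add: pell.simps pell_lucas.simps)

lemma pell_rec: "pell n = 2 * pell (n - 1) + pell (n - 2)"
proof (cases "n > 1")
  case True
  then show ?thesis by (subst pell.simps) simp
next
  case False
  then have "pell (n - 2) = pell n - 2 * pell (n - 1)"
    by (subst pell.simps) simp
  then show ?thesis by simp
qed

lemma pell_lucas_rec: "pell_lucas n = 2 * pell_lucas (n - 1) + pell_lucas (n - 2)"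
proof (cases "n > 1")
  case True
  then show ?thesis by (subst pell_lucas.simps) simp
next
  case False
  then have "pell_lucas (n - 2) = pell_lucas n - 2 * pell_lucas (n - 1)"
    by (subst pell_lucas.simps) simp
  then show ?thesis by simp
qed

definition bicomplex_pell :: "int \<Rightarrow> bicomplex" where
  "bicomplex_pell n =
     of_int (pell n) + bc_i * of_int (pell (n + 1)) + bc_j * of_int (pell (n + 2))
       + bc_i * bc_j * of_int (pell (n + 3))"

lemma bicomplex_pell_expand:
  "bicomplex_pell n = Bicomplex (pell n) (pell (n + 1)) (pell (n + 2)) (pell (n + 3))"
  by (simp add: bicomplex_pell_def Bicomplex_expand)

text \<open>
  In the identity for \<open>BP n * conj_i (BP n) + BP (n - 1) * conj_i (BP (n - 1))\<close> the source
  prints \<open>2 (8 P (2 n + 2) + j Q (2 n + 2))\<close>. The sign of the real part is a misprint: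
  adding the identity \<open>BP n * conj_i (BP n) = 2 (- Q (2 n + 3) + j P (2 n + 3))\<close> for \<open>n\<close>
  and \<open>n - 1\<close> gives \<open>2 (- 8 P (2 n + 2) + j Q (2 n + 2))\<close>, and the printed version already
  fails for \<open>n = 0\<close> (\<open>-32 + 12 j\<close> against \<open>32 + 12 j\<close>).
\<close>

lemma printed_conj_i_sum_fails_at_0:
  "bicomplex_pell 0 * conj_i (bicomplex_pell 0)
     + bicomplex_pell (- 1) * conj_i (bicomplex_pell (- 1)) \<noteq>
   2 * (8 * of_int (pell 2) + bc_j * of_int (pell_lucas 2))"
proof -
  have "bicomplex_pell 0 * conj_i (bicomplex_pell 0)
     + bicomplex_pell (- 1) * conj_i (bicomplex_pell (- 1)) = Bicomplex (- 32) 0 12 0"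
    by (simp add: bicomplex_pell_expand conj_i_def times_bicomplex_def plus_bicomplex_def
        pell.simps)
  moreover have "2 * (8 * of_int (pell 2) + bc_j * of_int (pell_lucas 2)) = Bicomplex 32 0 12 0"
    by (simp add: Bicomplex_expand pell.simps pell_lucas.simps)
  ultimately show ?thesis
    by simp
qed

end

theory Submission
  imports Defs
begin

text \<open>
  Each conjugation fixes two of the four basis vectors, so a bicomplex number times its conjugate
  lies in the plane spanned by those two: \<open>1, j\<close> for \<^const>\<open>conj_i\<close>, \<open>1, i\<close> for
  \<^const>\<open>conj_j\<close> and \<open>1, ij\<close> for \<^const>\<open>conj_ij\<close>. For a bicomplex Pell number the two
  coordinates are quadratic forms in consecutive Pell numbers, hence in \<open>P n\<close> and \<open>P (n + 1)\<close>
  alone. The doubling formulas \<open>P (2 n + 1) = P n\<^sup>2 + P (n + 1)\<^sup>2\<close> and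
  \<open>P (2 n + 2) = P (n + 1) (P n + P (n + 2))\<close>, which are instances of the addition formula
  \<open>pell_add\<close>, together with \<open>Q n = P (n + 1) + P (n - 1)\<close>, turn the right-hand sides into
  quadratic forms in the same two numbers, and comparing coefficients finishes. Only the \<open>ij\<close>
  coordinate needs another input: it is a multiple of \<open>P (n + 1)\<^sup>2 - P n P (n + 2)\<close>, which is
  \<open>(- 1) ^ n\<close> by Cassini's identity.

  The last three identities follow by adding two neighbouring instances of the first three.
  In the \<^const>\<open>conj_j\<close> case the squares telescope to \<open>P (n - 1)\<^sup>2 - P (n + 3)\<^sup>2\<close>, and in the
  \<^const>\<open>conj_ij\<close> case the alternating \<open>ij\<close> parts cancel. The index \<open>n - 1\<close> can be
  negative, so all these facts are proved over the integers.
\<close>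

text \<open>
  The recurrence can be run in both directions, so two initial values determine a sequence on all
  of \<open>\<int>\<close>. Carrying two neighbouring values through the induction covers the second-order step.
\<close>

lemma pell_recurrence_unique:
  fixes f g :: "int \<Rightarrow> int"
  assumes f: "\<And>n. f n = 2 * f (n - 1) + f (n - 2)"
    and g: "\<And>n. g n = 2 * g (n - 1) + g (n - 2)"
    and init: "f 0 = g 0" "f 1 = g 1"
  shows "f n = g n"
proof -
  have "f n = g n \<and> f (n + 1) = g (n + 1)"
  proof (induction n rule: int_induct[where k = 0])
    case base
    show ?case using init by simp
  next
    case (step1 i)
    then show ?case using f[of "i + 2"] g[of "i + 2"] by (simp add: add.commute)
  next
    case (step2 i)
    then show ?case using f[of "i + 1"] g[of "i + 1"] by simp
  qed
  then show ?thesis ..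
qed

lemma pell_plus_2: "pell (n + 2) = 2 * pell (n + 1) + pell n"
  using pell_rec[of "n + 2"] by (simp add: algebra_simps)

lemma pell_plus_3: "pell (n + 3) = 5 * pell (n + 1) + 2 * pell n"
  using pell_plus_2[of "n + 1"] pell_plus_2[of n] by (simp add: algebra_simps)

lemma pell_minus_1: "pell (n - 1) = pell (n + 1) - 2 * pell n"
  using pell_plus_2[of "n - 1"] by (simp add: algebra_simps)

lemma pell_2: "pell 2 = 2" and pell_at_minus_1: "pell (- 1) = 1"
  using pell_plus_2[of 0] pell_plus_2[of "- 1"] by (simp_all add: pell_0 pell_1)

lemma pell_lucas_eq_pell_sum: "pell_lucas n = pell (n + 1) + pell (n - 1)"
proof (rule pell_recurrence_unique[where n = n])
  show "pell_lucas n = 2 * pell_lucas (n - 1) + pell_lucas (n - 2)" for n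
    by (rule pell_lucas_rec)
  show "pell (n + 1) + pell (n - 1)
      = 2 * (pell (n - 1 + 1) + pell (n - 1 - 1)) + (pell (n - 2 + 1) + pell (n - 2 - 1))" for n
    using pell_rec[of "n + 1"] pell_rec[of "n - 1"] by (simp add: algebra_simps)
qed (simp_all add: pell_lucas_0 pell_lucas_1 pell_0 pell_1 pell_2 pell_at_minus_1)

text \<open>For fixed \<open>n\<close> both sides satisfy the Pell recurrence in \<open>m\<close>.\<close>

lemma pell_add: "pell (m + n + 1) = pell (m + 1) * pell (n + 1) + pell m * pell n"
proof (rule pell_recurrence_unique[where n = m])
  show "pell (m + n + 1) = 2 * pell (m - 1 + n + 1) + pell (m - 2 + n + 1)" for m
    using pell_rec[of "m + n + 1"] by (simp add: algebra_simps)
  show "pell (m + 1) * pell (n + 1) + pell m * pell n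
      = 2 * (pell (m - 1 + 1) * pell (n + 1) + pell (m - 1) * pell n)
        + (pell (m - 2 + 1) * pell (n + 1) + pell (m - 2) * pell n)" for m
    using pell_rec[of "m + 1"] pell_rec[of m] by (simp add: algebra_simps)
  show "pell (0 + n + 1) = pell (0 + 1) * pell (n + 1) + pell 0 * pell n"
    by (simp add: pell_0 pell_1)
  show "pell (1 + n + 1) = pell (1 + 1) * pell (n + 1) + pell 1 * pell n"
    using pell_plus_2[of n] pell_plus_2[of 0] by (simp add: pell_0 pell_1 add.commute)
qed

lemma pell_double_plus_1: "pell (2 * n + 1) = (pell n)\<^sup>2 + (pell (n + 1))\<^sup>2"
  using pell_add[of n n] by (simp add: power2_eq_square)

lemma pell_double_plus_2:
  "pell (2 * n + 2) = 2 * pell (n + 1) * (pell n + pell (n + 1))"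
  using pell_add[of "n + 1" n] pell_plus_2[of n] by (simp add: algebra_simps)

lemma pell_double_plus_3:
  "pell (2 * n + 3) = (pell n)\<^sup>2 + 4 * pell n * pell (n + 1) + 5 * (pell (n + 1))\<^sup>2"
  using pell_plus_2[of "2 * n + 1"] pell_double_plus_1[of n] pell_double_plus_2[of n]
  by (simp add: algebra_simps power2_eq_square)

lemma pell_lucas_double_plus_2: "pell_lucas (2 * n + 2) = pell (2 * n + 3) + pell (2 * n + 1)"
  using pell_lucas_eq_pell_sum[of "2 * n + 2"] by (simp add: algebra_simps)

lemma pell_lucas_double_plus_3:
  "pell_lucas (2 * n + 3) = 2 * pell (2 * n + 3) + 2 * pell (2 * n + 2)"
  using pell_lucas_eq_pell_sum[of "2 * n + 3"] pell_plus_2[of "2 * n + 2"]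
  by (simp add: algebra_simps)

lemma pell_cassini_step:
  "(pell (n + 1))\<^sup>2 - pell n * pell (n + 2) = - ((pell n)\<^sup>2 - pell (n - 1) * pell (n + 1))"
  by (simp add: pell_plus_2 pell_minus_1 algebra_simps power2_eq_square)

lemma pell_cassini:
  "(pell (int n + 1))\<^sup>2 - pell (int n) * pell (int n + 2) = (- 1) ^ n"
proof (induction n)
  case 0
  show ?case by (simp add: pell_0 pell_1)
next
  case (Suc n)
  then show ?case using pell_cassini_step[of "int n + 1"] by (simp add: algebra_simps)
qed

lemma bicomplex_pell_times_conj_i:
  "bicomplex_pell n * conj_i (bicomplex_pell n)
     = Bicomplex (- 2 * pell_lucas (2 * n + 3)) 0 (2 * pell (2 * n + 3)) 0"
  unfolding pell_lucas_double_plus_3 pell_double_plus_3 pell_double_plus_2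
  by (simp add: bicomplex_pell_expand conj_i_def times_bicomplex_def pell_plus_2 pell_plus_3)
    (simp add: algebra_simps power2_eq_square)

lemma bicomplex_pell_times_conj_j:
  "bicomplex_pell n * conj_j (bicomplex_pell n)
     = Bicomplex ((pell n)\<^sup>2 - (pell (n + 1))\<^sup>2 + (pell (n + 2))\<^sup>2 - (pell (n + 3))\<^sup>2)
         (4 * (pell (2 * n + 3) + pell n * pell (n + 1))) 0 0"
  unfolding pell_double_plus_3
  by (simp add: bicomplex_pell_expand conj_j_def times_bicomplex_def pell_plus_2 pell_plus_3)
    (simp add: algebra_simps power2_eq_square)

text \<open>
  The \<open>ij\<close> coordinate \<open>2 (P n P (n + 3) - P (n + 1) P (n + 2))\<close> is rewritten as a multiple of
  Cassini's expression, whose sign alternates with \<open>n\<close>.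
\<close>

lemma bicomplex_pell_times_conj_ij:
  "bicomplex_pell n * conj_ij (bicomplex_pell n)
     = Bicomplex (6 * pell (2 * n + 3)) 0 0
         (- 4 * ((pell (n + 1))\<^sup>2 - pell n * pell (n + 2)))"
  unfolding pell_double_plus_3
  by (simp add: bicomplex_pell_expand conj_ij_def times_bicomplex_def pell_plus_2 pell_plus_3)
    (simp add: algebra_simps power2_eq_square)

lemma bicomplex_pell_conj_i_sum:
  "bicomplex_pell n * conj_i (bicomplex_pell n)
     + bicomplex_pell (n - 1) * conj_i (bicomplex_pell (n - 1))
     = Bicomplex (- 16 * pell (2 * n + 2)) 0 (2 * pell_lucas (2 * n + 2)) 0"
proof -
  have "pell_lucas (2 * n + 3) + pell_lucas (2 * n + 1) = 8 * pell (2 * n + 2)"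
    using pell_lucas_double_plus_3[of n] pell_lucas_double_plus_3[of "n - 1"]
      pell_plus_2[of "2 * n + 1"] pell_plus_2[of "2 * n"]
    by (simp add: algebra_simps)
  then have "real_of_int (pell_lucas (2 * n + 3)) + pell_lucas (2 * n + 1) = 8 * pell (2 * n + 2)"
    by linarith
  then show ?thesis
    by (simp add: bicomplex_pell_times_conj_i plus_bicomplex_def pell_lucas_double_plus_2
        add.commute[of 1])
qed

lemma bicomplex_pell_conj_j_sum:
  "bicomplex_pell n * conj_j (bicomplex_pell n)
     + bicomplex_pell (n - 1) * conj_j (bicomplex_pell (n - 1))
     = Bicomplex (- 12 * pell (2 * n + 2)) (12 * pell (2 * n + 2)) 0 0"
proof -
  have "(pell (n - 1))\<^sup>2 - (pell (n + 3))\<^sup>2 = - 12 * pell (2 * n + 2)"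
    unfolding pell_minus_1 pell_plus_3 pell_double_plus_2
    by (simp add: algebra_simps power2_eq_square)
  then have re: "real_of_int ((pell (n - 1))\<^sup>2 - (pell (n + 3))\<^sup>2)
      = real_of_int (- 12 * pell (2 * n + 2))"
    by (simp only:)
  have "4 * (pell (2 * n + 3) + pell n * pell (n + 1))
      + 4 * (pell (2 * n + 1) + pell (n - 1) * pell n) = 12 * pell (2 * n + 2)"
    unfolding pell_minus_1 pell_double_plus_1 pell_double_plus_2 pell_double_plus_3
    by (simp add: algebra_simps power2_eq_square)
  then have im: "real_of_int (4 * (pell (2 * n + 3) + pell n * pell (n + 1))
      + 4 * (pell (2 * n + 1) + pell (n - 1) * pell n)) = real_of_int (12 * pell (2 * n + 2))"
    by (simp only:)
  show ?thesis
    using re im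
    by (simp add: bicomplex_pell_times_conj_j plus_bicomplex_def add.commute[of 1]
        add.commute[of 2])
qed

lemma bicomplex_pell_conj_ij_sum:
  "bicomplex_pell n * conj_ij (bicomplex_pell n)
     + bicomplex_pell (n - 1) * conj_ij (bicomplex_pell (n - 1))
     = Bicomplex (6 * pell_lucas (2 * n + 2)) 0 0 0"
proof -
  have "real_of_int ((pell (n + 1))\<^sup>2 - pell n * pell (n + 2))
      = real_of_int (- ((pell n)\<^sup>2 - pell (n - 1) * pell (n + 1)))"
    by (simp only: pell_cassini_step)
  then show ?thesis
    by (simp add: bicomplex_pell_times_conj_ij plus_bicomplex_def pell_lucas_double_plus_2
        add.commute[of 1])
qed

text \<open>
  The right-hand sides use integers and numerals as bicomplex scalars; comparing coordinates
  needs them as explicit quadruples.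
\<close>

lemma of_int_bicomplex: "of_int k = Bicomplex (of_int k) 0 0 0"
  using Bicomplex_expand[of "of_int k" 0 0 0] by simp

lemma numeral_bicomplex: "numeral k = Bicomplex (numeral k) 0 0 0"
  using of_int_bicomplex[of "numeral k"] by simp

theorem theorem2p2:
  fixes n :: nat
  shows
    "(bicomplex_pell (int n) * conj_i (bicomplex_pell (int n)) =
        2 * (- of_int (pell_lucas (2 * int n + 3)) + bc_j * of_int (pell (2 * int n + 3)))) \<and>
     (bicomplex_pell (int n) * conj_j (bicomplex_pell (int n)) =
        of_int ((pell (int n))\<^sup>2 - (pell (int n + 1))\<^sup>2 + (pell (int n + 2))\<^sup>2 - (pell (int n + 3))\<^sup>2)
        + 4 * bc_i * of_int (pell (2 * int n + 3) + pell (int n) * pell (int n + 1))) \<and>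
     (bicomplex_pell (int n) * conj_ij (bicomplex_pell (int n)) =
        6 * of_int (pell (2 * int n + 3)) + 4 * (bc_i * bc_j) * (- 1) ^ (n + 1)) \<and>
     (bicomplex_pell (int n) * conj_i (bicomplex_pell (int n))
        + bicomplex_pell (int n - 1) * conj_i (bicomplex_pell (int n - 1)) =
        2 * (- 8 * of_int (pell (2 * int n + 2)) + bc_j * of_int (pell_lucas (2 * int n + 2)))) \<and>
     (bicomplex_pell (int n) * conj_j (bicomplex_pell (int n))
        + bicomplex_pell (int n - 1) * conj_j (bicomplex_pell (int n - 1)) =
        12 * (- of_int (pell (2 * int n + 2)) + bc_i * of_int (pell (2 * int n + 2)))) \<and>
     (bicomplex_pell (int n) * conj_ij (bicomplex_pell (int n))
        + bicomplex_pell (int n - 1) * conj_ij (bicomplex_pell (int n - 1)) =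
        6 * of_int (pell_lucas (2 * int n + 2)))"
proof -
  note coords = of_int_bicomplex numeral_bicomplex bc_i_def bc_j_def
    plus_bicomplex_def times_bicomplex_def uminus_bicomplex_def
  \<comment> \<open>Written as an integer, the sign has known coordinates.\<close>
  have sign: "(- 1 :: bicomplex) ^ (n + 1) = of_int (- ((- 1) ^ n))"
    by simp
  show ?thesis
    unfolding bicomplex_pell_conj_i_sum bicomplex_pell_conj_j_sum bicomplex_pell_conj_ij_sum
    unfolding bicomplex_pell_times_conj_i bicomplex_pell_times_conj_j bicomplex_pell_times_conj_ij
      pell_cassini sign
    by (simp add: coords)
qed

end
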